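(* For every graph $E$, the identity map $\mathrm{id}_{S(E)}\colon S(E)\to S(E)$ is a regular extended path homomorphism. Moreover, for all graphs $E,F,G$ and all regular extended path homomorphisms $\varphi\colon S(E)\to S(F)$ and $\psi\colon S(F)\to S(G)$, the composition $\psi\circ\varphi\colon S(E)\to S(G)$ is a regular extended path homomorphism. Consequently, all graphs together with all regular extended path homomorphisms form a subcategory, denoted $\mathsf{REG}$, of the category $\mathsf{EG}$ of graphs and extended path homomorphisms.
   Context: A graph $E=(E^0,E^1,s_E,t_E)$ consists of arbitrary sets $E^0$ (vertices), $E^1$ (edges) and maps $s_E,t_E\colon E^1\to E^0$ (source, target). A vertex $v$ is regular if $s_E^{-1}(v)$ is finite and nonempty; $\mathrm{reg}(E)$ is the set of regular vertices. $\mathrm{FP}(E)$ is the set of finite paths: vertices (length $0$) and sequences $e_1\ldots e_n$ of edges with $t_E(e_i)=s_E(e_{i+1})$; source and target extend to paths, and paths are concatenated when target and source match (vertices act as units). The graph inverse semigroup is $S(E)=\{(\alpha,\beta)\in \mathrm{FP}(E)^2\mid t_E(\alpha)=t_E(\beta)\}\cup\{0\}$ with $(\alpha,\beta)(\gamma,\delta)=(\alpha\gamma',\delta)$ if $\gamma=\beta\gamma'$, $=(\alpha,\delta\beta')$ if $\beta=\gamma\beta'$, and $=0$ otherwise; $0$ times anything is $0$. It is an inverse semigroup with $(\alpha,\beta)^*=(\beta,\alpha)$; its natural partial order is $s\le t\iff ss^*t=s$. An extended path homomorphism from $E$ to $F$ is a semigroup homomorphism $\varphi\colon S(E)\to S(F)$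 with $\varphi(0)=0$. The category $\mathsf{EG}$ has all graphs as objects and extended path homomorphisms as morphisms, with composition of maps. An extended path homomorphism $\varphi\colon S(E)\to S(F)$ is regular if whenever $u\in\mathrm{reg}(E)$, $t\in S(F)\setminus\{0\}$ and $t\le\varphi(u,u)$, there exists $e\in s_E^{-1}(u)$ such that $t\varphi(e,e)\neq 0$. *)

theory Defs
  imports "Graph_Theory.Arc_Walk" "HOL-Library.FuncSet"
begin

text \<open>
  A graph is a \<^typ>\<open>('v, 'e) pre_digraph\<close> satisfying \<^locale>\<open>wf_digraph\<close>; \<^const>\<open>tail\<close> is the source map
  and \<^const>\<open>head\<close> the target map.  Vertex and edge sets may be infinite or empty, and loops and
  parallel edges are allowed.
\<close>

definition reg :: "('v, 'e) pre_digraph \<Rightarrow> 'v set" where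
  "reg E = {v \<in> verts E. finite (out_arcs E v) \<and> out_arcs E v \<noteq> {}}"


section \<open>Finite paths\<close>

text \<open>
  A path is stored as its source together with its list of edges: a vertex \<open>v\<close> is \<open>(v, [])\<close>, and
  \<open>e\<^sub>1 \<dots> e\<^sub>n\<close> with \<open>n \<ge> 1\<close> is \<open>(tail E e\<^sub>1, [e\<^sub>1, \<dots>, e\<^sub>n])\<close>.  In the latter case the first component
  is determined by the edge list, by the definition of \<^const>\<open>pre_digraph.awalk\<close>.
\<close>

type_synonym ('v, 'e) fpath = "'v \<times> 'e list"

definition FP :: "('v, 'e) pre_digraph \<Rightarrow> ('v, 'e) fpath set" where
  "FP E = {(u, p). \<exists>v. pre_digraph.awalk E u p v}"

definition path_source :: "('v, 'e) fpath \<Rightarrow> 'v" where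
  "path_source \<alpha> = fst \<alpha>"

definition path_target :: "('v, 'e) pre_digraph \<Rightarrow> ('v, 'e) fpath \<Rightarrow> 'v" where
  "path_target E \<alpha> = pre_digraph.awlast E (fst \<alpha>) (snd \<alpha>)"

definition vertex_path :: "'v \<Rightarrow> ('v, 'e) fpath" where
  "vertex_path v = (v, [])"

definition edge_path :: "('v, 'e) pre_digraph \<Rightarrow> 'e \<Rightarrow> ('v, 'e) fpath" where
  "edge_path E e = (tail E e, [e])"

text \<open>Concatenation; only meaningful if the target of \<open>\<alpha>\<close> is the source of \<open>\<beta>\<close>.\<close>

definition path_concat :: "('v, 'e) fpath \<Rightarrow> ('v, 'e) fpath \<Rightarrow> ('v, 'e) fpath" where
  "path_concat \<alpha> \<beta> = (fst \<alpha>, snd \<alpha> @ snd \<beta>)"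

text \<open>\<open>is_remainder E \<beta> \<gamma> \<gamma>'\<close> says that \<open>\<gamma> = \<beta>\<gamma>'\<close> in \<open>FP E\<close>; such a \<open>\<gamma>'\<close> is unique.\<close>

definition is_remainder ::
    "('v, 'e) pre_digraph \<Rightarrow> ('v, 'e) fpath \<Rightarrow> ('v, 'e) fpath \<Rightarrow> ('v, 'e) fpath \<Rightarrow> bool" where
  "is_remainder E \<beta> \<gamma> \<gamma>' \<longleftrightarrow>
     \<gamma>' \<in> FP E \<and> path_target E \<beta> = path_source \<gamma>' \<and> \<gamma> = path_concat \<beta> \<gamma>'"


section \<open>The graph inverse semigroup\<close>

datatype ('v, 'e) gis = Zero | Elem "('v, 'e) fpath" "('v, 'e) fpath"

definition S :: "('v, 'e) pre_digraph \<Rightarrow> ('v, 'e) gis set" where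
  "S E = {Elem \<alpha> \<beta> | \<alpha> \<beta>. \<alpha> \<in> FP E \<and> \<beta> \<in> FP E \<and> path_target E \<alpha> = path_target E \<beta>} \<union> {Zero}"

text \<open>
  If both of the first two cases apply then \<open>\<beta> = \<gamma>\<close> and both give \<open>(\<alpha>, \<delta>)\<close>.
\<close>

fun gis_mult :: "('v, 'e) pre_digraph \<Rightarrow> ('v, 'e) gis \<Rightarrow> ('v, 'e) gis \<Rightarrow> ('v, 'e) gis" where
  "gis_mult E (Elem \<alpha> \<beta>) (Elem \<gamma> \<delta>) =
     (if \<exists>\<gamma>'. is_remainder E \<beta> \<gamma> \<gamma>'
      then Elem (path_concat \<alpha> (THE \<gamma>'. is_remainder E \<beta> \<gamma> \<gamma>')) \<delta>
      else if \<exists>\<beta>'. is_remainder E \<gamma> \<beta> \<beta>'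
      then Elem \<alpha> (path_concat \<delta> (THE \<beta>'. is_remainder E \<gamma> \<beta> \<beta>'))
      else Zero)"
| "gis_mult E Zero t = Zero"
| "gis_mult E s Zero = Zero"

fun gis_star :: "('v, 'e) gis \<Rightarrow> ('v, 'e) gis" where
  "gis_star (Elem \<alpha> \<beta>) = Elem \<beta> \<alpha>"
| "gis_star Zero = Zero"

definition gis_le :: "('v, 'e) pre_digraph \<Rightarrow> ('v, 'e) gis \<Rightarrow> ('v, 'e) gis \<Rightarrow> bool" where
  "gis_le E s t \<longleftrightarrow> gis_mult E (gis_mult E s (gis_star s)) t = s"


section \<open>Extended path homomorphisms\<close>

text \<open>
  Maps \<open>S(E) \<rightarrow> S(F)\<close> are elements of the extensional function space \<open>S E \<rightarrow>\<^sub>E S F\<close>, so that HOL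
  equality is equality of maps on \<open>S(E)\<close>; identity and composition are the restricted ones.
\<close>

definition extended_path_hom ::
    "('v, 'e) pre_digraph \<Rightarrow> ('w, 'f) pre_digraph \<Rightarrow> (('v, 'e) gis \<Rightarrow> ('w, 'f) gis) \<Rightarrow> bool" where
  "extended_path_hom E F \<phi> \<longleftrightarrow>
     \<phi> \<in> S E \<rightarrow>\<^sub>E S F \<and>
     (\<forall>s\<in>S E. \<forall>t\<in>S E. \<phi> (gis_mult E s t) = gis_mult F (\<phi> s) (\<phi> t)) \<and>
     \<phi> Zero = Zero"

definition regular_extended_path_hom ::
    "('v, 'e) pre_digraph \<Rightarrow> ('w, 'f) pre_digraph \<Rightarrow> (('v, 'e) gis \<Rightarrow> ('w, 'f) gis) \<Rightarrow> bool" where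
  "regular_extended_path_hom E F \<phi> \<longleftrightarrow>
     extended_path_hom E F \<phi> \<and>
     (\<forall>u\<in>reg E. \<forall>t\<in>S F - {Zero}.
        gis_le F t (\<phi> (Elem (vertex_path u) (vertex_path u))) \<longrightarrow>
        (\<exists>e\<in>out_arcs E u. gis_mult F t (\<phi> (Elem (edge_path E e) (edge_path E e))) \<noteq> Zero))"

abbreviation id_hom :: "('v, 'e) pre_digraph \<Rightarrow> ('v, 'e) gis \<Rightarrow> ('v, 'e) gis" where
  "id_hom E \<equiv> (\<lambda>s\<in>S E. s)"


section \<open>Categories and subcategories\<close>

text \<open>
  Categories are given by families of hom-sets, which need not be disjoint; hence identities and
  composition are indexed by objects, and \<open>compos C A B D g f\<close> is \<open>g \<circ> f\<close> for \<open>f : A \<rightarrow> B\<close>, \<open>g : B \<rightarrow> D\<close>.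
\<close>

record ('o, 'm) precategory =
  obj :: "'o set"
  hom :: "'o \<Rightarrow> 'o \<Rightarrow> 'm set"
  ident :: "'o \<Rightarrow> 'm"
  compos :: "'o \<Rightarrow> 'o \<Rightarrow> 'o \<Rightarrow> 'm \<Rightarrow> 'm \<Rightarrow> 'm"

locale category =
  fixes C :: "('o, 'm) precategory"
  assumes ident_in_hom: "A \<in> obj C \<Longrightarrow> ident C A \<in> hom C A A"
    and comp_in_hom: "\<lbrakk>A \<in> obj C; B \<in> obj C; D \<in> obj C; f \<in> hom C A B; g \<in> hom C B D\<rbrakk>
      \<Longrightarrow> compos C A B D g f \<in> hom C A D"
    and comp_ident: "\<lbrakk>A \<in> obj C; B \<in> obj C; f \<in> hom C A B\<rbrakk> \<Longrightarrow> compos C A A B f (ident C A) = f"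
    and ident_comp: "\<lbrakk>A \<in> obj C; B \<in> obj C; f \<in> hom C A B\<rbrakk> \<Longrightarrow> compos C A B B (ident C B) f = f"
    and comp_assoc: "\<lbrakk>A \<in> obj C; B \<in> obj C; D \<in> obj C; K \<in> obj C;
        f \<in> hom C A B; g \<in> hom C B D; h \<in> hom C D K\<rbrakk>
      \<Longrightarrow> compos C A D K h (compos C A B D g f) = compos C A B K (compos C B D K h g) f"

definition subcategory :: "('o, 'm) precategory \<Rightarrow> ('o, 'm) precategory \<Rightarrow> bool" where
  "subcategory D C \<longleftrightarrow>
     category D \<and> category C \<and>
     obj D \<subseteq> obj C \<and>
     (\<forall>A\<in>obj D. \<forall>B\<in>obj D. hom D A B \<subseteq> hom C A B) \<and>
     (\<forall>A\<in>obj D. ident D A = ident C A) \<and>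
     (\<forall>A\<in>obj D. \<forall>B\<in>obj D. \<forall>K\<in>obj D. \<forall>f\<in>hom D A B. \<forall>g\<in>hom D B K.
        compos D A B K g f = compos C A B K g f)"

text \<open>
  The types \<open>'v\<close> and \<open>'e\<close> play the role of the universe: the objects are all graphs with vertices
  in \<open>'v\<close> and edges in \<open>'e\<close>.
\<close>

definition EG :: "(('v, 'e) pre_digraph, ('v, 'e) gis \<Rightarrow> ('v, 'e) gis) precategory" where
  "EG = \<lparr>obj = {E. wf_digraph E},
         hom = (\<lambda>E F. {\<phi>. extended_path_hom E F \<phi>}),
         ident = (\<lambda>E. id_hom E),
         compos = (\<lambda>E F G \<psi> \<phi>. compose (S E) \<psi> \<phi>)\<rparr>"

definition REG :: "(('v, 'e) pre_digraph, ('v, 'e) gis \<Rightarrow> ('v, 'e) gis) precategory" where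
  "REG = \<lparr>obj = {E. wf_digraph E},
          hom = (\<lambda>E F. {\<phi>. regular_extended_path_hom E F \<phi>}),
          ident = (\<lambda>E. id_hom E),
          compos = (\<lambda>E F G \<psi> \<phi>. compose (S E) \<psi> \<phi>)\<rparr>"

end

theory Submission
  imports Defs "HOL-Library.Sublist"
begin

text \<open>
  Let \<open>u\<close> be regular and \<open>\<phi>(u,u) = (\<alpha>,\<alpha>)\<close>.  Regularity of \<open>\<phi>\<close> says that the finitely many nonzero
  idempotents \<open>\<phi>(e,e) = (\<gamma>,\<gamma>)\<close>, with \<open>e\<close> an edge leaving \<open>u\<close>, form a cover: every path extending \<open>\<alpha>\<close> is
  comparable with some \<open>\<gamma>\<close>.  Suppose \<open>0 \<noteq> t \<le> \<psi>(\<alpha>,\<alpha>)\<close> is orthogonal to all \<open>\<psi>(\<gamma>,\<gamma>)\<close>, and let \<open>\<delta>\<close> extend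
  \<open>\<alpha>\<close> with \<open>t \<psi>(\<delta>,\<delta>) \<noteq> 0\<close>.  Then no \<open>\<gamma>\<close> is a prefix of \<open>\<delta>\<close>, so each one-edge prolongation of \<open>\<delta>\<close> is a
  prefix of some \<open>\<gamma>\<close>, and hence the target of \<open>\<delta>\<close> is regular.  Conjugating by \<open>\<psi>(\<delta>,v)\<close>, where \<open>v\<close> is
  that target, regularity of \<open>\<psi>\<close> yields a prolongation \<open>\<delta>f\<close> with \<open>t \<psi>(\<delta>f,\<delta>f) \<noteq> 0\<close>.  So there are
  arbitrarily long such \<open>\<delta>\<close>, contradicting finiteness.
\<close>

section \<open>A graph-free form of the multiplication\<close>

text \<open>Two paths with the same source are compared through their edge lists alone, so no graph
  is mentioned. Laws such as associativity then hold on the whole type and need no membership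
  conditions.\<close>

fun gmul :: "('v, 'e) gis \<Rightarrow> ('v, 'e) gis \<Rightarrow> ('v, 'e) gis" (infixl "\<odot>" 70) where
  "Elem (u, p) (v, q) \<odot> Elem (v', r) (w, s) =
     (if v \<noteq> v' then Zero
      else if prefix q r then Elem (u, p @ drop (length q) r) (w, s)
      else if prefix r q then Elem (u, p) (w, s @ drop (length r) q)
      else Zero)"
| "Zero \<odot> t = Zero"
| "s \<odot> Zero = Zero"

lemma gmul_Zero_right [simp]: "s \<odot> Zero = Zero"
  by (cases s) auto

lemma gmul_append_right: "Elem \<alpha> (v, q) \<odot> Elem (v, q @ x) \<delta> = Elem (fst \<alpha>, snd \<alpha> @ x) \<delta>"
  by (cases \<alpha>; cases \<delta>) simp

lemma gmul_append_left: "Elem \<alpha> (v, q @ x) \<odot> Elem (v, q) \<delta> = Elem \<alpha> (fst \<delta>, snd \<delta> @ x)"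
  by (cases \<alpha>; cases \<delta>) simp

lemma gmul_eq_Zero: "\<not> (v = w \<and> (prefix q r \<or> prefix r q)) \<Longrightarrow> Elem \<alpha> (v, q) \<odot> Elem (w, r) \<delta> = Zero"
  by (cases \<alpha>; cases \<delta>) auto

text \<open>Incomparable paths stay incomparable when either is prolonged. The third alternative
  records this for all prolongations, because a neighbouring product may already have lengthened one
  of the two paths.\<close>

lemma gmul_Elem_cases:
  obtains x where "v = w" "r = q @ x" | x where "v = w" "q = r @ x"
  | "\<And>\<alpha> \<delta> x y. Elem \<alpha> (v, q @ x) \<odot> Elem (w, r @ y) \<delta> = Zero"
proof (cases "v = w \<and> (prefix q r \<or> prefix r q)")
  case True
  then show ?thesis using that(1,2) by (auto simp: prefix_def)
next
  case False
  then have "\<not> (v = w \<and> (prefix (q @ x) (r @ y) \<or> prefix (r @ y) (q @ x)))" for x y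
    by (meson append_prefixD prefix_same_cases prefixI)
  then show ?thesis
    by (intro that(3) gmul_eq_Zero)
qed

text \<open>The second component of \<open>r\<close> is compared with the first of \<open>s\<close>,
  and the second of \<open>s\<close> with the first of \<open>t\<close>. This gives nine cases, each
  of which is a computation with appended lists.\<close>

lemma gmul_assoc: "(r \<odot> s) \<odot> t = r \<odot> (s \<odot> t)"
proof (cases "r = Zero \<or> s = Zero \<or> t = Zero")
  case True
  then show ?thesis by auto
next
  case False
  then obtain \<alpha> b q c p d q' e p' \<delta> where
    rst: "r = Elem \<alpha> (b, q)" "s = Elem (c, p) (d, q')" "t = Elem (e, p') \<delta>"
    by (metis gis.exhaust surj_pair)
  consider (right) x where "b = c" "p = q @ x" | (left) x where "b = c" "q = p @ x"
    | (zero) "\<And>\<alpha> \<delta> x y. Elem \<alpha> (b, q @ x) \<odot> Elem (c, p @ y) \<delta> = Zero"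
    by (rule gmul_Elem_cases[of b c p q]) blast+
  note rs_cases = this
  consider (right) y where "d = e" "p' = q' @ y" | (left) y where "d = e" "q' = p' @ y"
    | (zero) "\<And>\<alpha> \<delta> x y. Elem \<alpha> (d, q' @ x) \<odot> Elem (e, p' @ y) \<delta> = Zero"
    by (rule gmul_Elem_cases[of d e p' q']) blast+
  then show ?thesis
  proof cases
    case right: (right y)
    show ?thesis
      using rs_cases
    proof cases
      case (right x)
      then show ?thesis
        by (simp add: rst \<open>p' = q' @ y\<close> \<open>d = e\<close> gmul_append_right)
    next
      case (left x)
      \<comment> \<open>This is the only case in which both neighbours overhang \<open>s\<close>. On
        either side of the law it remains to compare \<open>x\<close> with \<open>y\<close>, since a
        common initial part does not affect the product.\<close>
      have "Elem \<alpha> (b, p @ x) \<odot> Elem (c, p @ y) \<delta> = Elem \<alpha> (e, q' @ x) \<odot> Elem (d, q' @ y) \<delta>"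
        using left(1) right(1) by (cases \<alpha>; cases \<delta>) simp
      with left right show ?thesis
        by (simp add: rst gmul_append_right gmul_append_left)
    next
      case zero
      with zero[of _ "[]" "[]"] zero[of _ "[]"] right show ?thesis
        by (simp add: rst gmul_append_right)
    qed
  next
    case left: (left y)
    show ?thesis
      using rs_cases
    proof cases
      case (right x)
      with left show ?thesis
        by (simp add: rst gmul_append_right gmul_append_left)
    next
      case (left x)
      then show ?thesis
        by (simp add: rst \<open>q' = p' @ y\<close> \<open>d = e\<close> gmul_append_left)
    next
      case zero
      with zero[of _ "[]" "[]"] left show ?thesis
        by (simp add: rst gmul_append_left)
    qed
  next
    case zero
    note right_zero = zero[of _ "[]" "[]", unfolded append_Nil2] zero[of _ _ "[]", unfolded append_Nil2]
    show ?thesis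
      using rs_cases
    proof cases
      case zero
      then show ?thesis
        using zero[of _ "[]" "[]"] right_zero by (simp add: rst del: gmul.simps(1))
    qed (simp_all add: rst right_zero gmul_append_right gmul_append_left del: gmul.simps(1))
  qed
qed

section \<open>Idempotents and their products\<close>

lemma idempotent_cases:
  assumes "s \<odot> s = s"
  obtains "s = Zero" | \<alpha> where "s = Elem \<alpha> \<alpha>"
proof (cases s)
  case (Elem \<alpha> \<beta>)
  with assms have "\<alpha> = \<beta>"
    by (cases \<alpha>; cases \<beta>) (auto simp: prefix_def split: if_splits)
  with Elem that show ?thesis by blast
qed (use that in blast)

lemma gmul_self [simp]: "Elem \<alpha> \<alpha> \<odot> Elem \<alpha> \<alpha> = Elem \<alpha> \<alpha>"
  by (cases \<alpha>) auto

text \<open>The product of two nonzero idempotents is the one at the longer path if the paths are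
  comparable and \<open>Zero\<close> otherwise, which is symmetric.\<close>

lemma idempotents_commute:
  assumes "s \<odot> s = s" "t \<odot> t = t"
  shows "s \<odot> t = t \<odot> s"
proof -
  have "Elem \<alpha> \<alpha> \<odot> Elem \<beta> \<beta> = Elem \<beta> \<beta> \<odot> Elem \<alpha> \<alpha>" for \<alpha> \<beta> :: "('a, 'b) fpath"
    by (cases \<alpha>; cases \<beta>) (auto simp: prefix_def)
  then show ?thesis
    using assms by (auto elim!: idempotent_cases)
qed

lemma gmul_star: "s \<odot> s = s \<Longrightarrow> s \<odot> gis_star s = s"
  by (erule idempotent_cases) auto

lemma gmul_star_self_idem: "(s \<odot> gis_star s) \<odot> (s \<odot> gis_star s) = s \<odot> gis_star s"
  by (cases s) auto

lemma gmul_idem_nonzero_iff: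
  "Elem (u, p) (u, p) \<odot> Elem (v, q) (v, q) \<noteq> Zero \<longleftrightarrow> u = v \<and> (prefix p q \<or> prefix q p)"
  by (auto simp: prefix_def)

lemma gmul_idem_prefix:
  "prefix p q \<Longrightarrow> Elem (u, p) (u, p) \<odot> Elem (u, q) (u, q) = Elem (u, q) (u, q)"
  by (auto simp: prefix_def)

section \<open>Comparison with the given multiplication\<close>

context wf_digraph
begin

lemma FP_append_iff: "(u, p @ q) \<in> FP G \<longleftrightarrow> (u, p) \<in> FP G \<and> (awlast u p, q) \<in> FP G"
  by (auto simp: FP_def)

lemma FP_Nil_iff [simp]: "(u, []) \<in> FP G \<longleftrightarrow> u \<in> verts G"
  by (auto simp: FP_def awalk_Nil_iff)

lemma FP_Cons_iff: "(u, e # p) \<in> FP G \<longleftrightarrow> e \<in> arcs G \<and> tail G e = u \<and> (head G e, p) \<in> FP G"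
  by (auto simp: FP_def awalk_Cons_iff)

text \<open>Whatever follows an initial part of a path is itself a path from the target of that
  part. Hence the side conditions on the remainder are automatic, and prefix comparison in
  \<open>gmul\<close> is faithful on \<open>S G\<close>.\<close>

lemma is_remainder_iff:
  assumes "(v, r) \<in> FP G"
  shows "is_remainder G (u, q) (v, r) \<gamma> \<longleftrightarrow>
    u = v \<and> prefix q r \<and> \<gamma> = (awlast u q, drop (length q) r)"
  using assms
  by (cases \<gamma>)
    (auto simp: is_remainder_def path_source_def path_target_def path_concat_def prefix_def FP_append_iff)

lemma The_is_remainder:
  assumes "(v, r) \<in> FP G" "prefix q r"
  shows "The (is_remainder G (v, q) (v, r)) = (awlast v q, drop (length q) r)"
  using assms by (intro the_equality) (auto simp: is_remainder_iff)

lemma gis_mult_eq: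
  assumes "s \<in> S G" "t \<in> S G"
  shows "gis_mult G s t = s \<odot> t"
proof (cases "s = Zero \<or> t = Zero")
  case True
  then show ?thesis by (cases s) auto
next
  case False
  then obtain a p b q c p' d q' where
    "s = Elem (a, p) (b, q)" "t = Elem (c, p') (d, q')"
    by (metis gis.exhaust surj_pair)
  with assms show ?thesis
    by (auto simp: S_def is_remainder_iff The_is_remainder path_concat_def)
qed

lemma Zero_in_S [simp]: "Zero \<in> S G"
  by (simp add: S_def)

lemma Elem_in_S_iff:
  "Elem (u, p) (v, q) \<in> S G \<longleftrightarrow> (u, p) \<in> FP G \<and> (v, q) \<in> FP G \<and> awlast u p = awlast v q"
  by (auto simp: S_def path_target_def)

lemma Elem_self_in_S [simp]: "Elem \<alpha> \<alpha> \<in> S G \<longleftrightarrow> \<alpha> \<in> FP G"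
  by (cases \<alpha>) (simp add: Elem_in_S_iff)

lemma awlast_append': "awlast u (p @ q) = awlast (awlast u p) q"
  by (induction p arbitrary: u) auto

lemma gmul_in_S:
  assumes "s \<in> S G" "t \<in> S G"
  shows "s \<odot> t \<in> S G"
proof (cases "s = Zero \<or> t = Zero")
  case True
  then show ?thesis by (cases s) auto
next
  case False
  then obtain a p b q c p' d q' where
    "s = Elem (a, p) (b, q)" "t = Elem (c, p') (d, q')"
    by (metis gis.exhaust surj_pair)
  with assms show ?thesis
    by (auto simp: Elem_in_S_iff prefix_def FP_append_iff awlast_append')
qed

lemma gis_star_in_S: "s \<in> S G \<Longrightarrow> gis_star s \<in> S G"
  by (cases s) (auto simp: S_def)

lemma gis_le_iff:
  assumes "s \<in> S G" "t \<in> S G"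
  shows "gis_le G s t \<longleftrightarrow> (s \<odot> gis_star s) \<odot> t = s"
  using assms by (simp add: gis_le_def gis_mult_eq gmul_in_S gis_star_in_S)

text \<open>An element below an idempotent \<open>t\<close> is a product of \<open>t\<close> with
  another idempotent, and idempotents commute; so it is idempotent, and the order becomes absorption
  by \<open>t\<close>.\<close>

lemma gis_le_idem_iff:
  assumes "s \<in> S G" "t \<in> S G" "t \<odot> t = t"
  shows "gis_le G s t \<longleftrightarrow> s \<odot> s = s \<and> s \<odot> t = s"
proof
  assume "gis_le G s t"
  define i where "i = s \<odot> gis_star s"
  have s: "s = i \<odot> t"
    using \<open>gis_le G s t\<close> assms gis_le_iff i_def by simp
  have i: "i \<odot> i = i"
    unfolding i_def by (rule gmul_star_self_idem)
  have "s \<odot> t = s"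
    using s assms(3) by (simp add: gmul_assoc)
  moreover have "s \<odot> s = s"
    by (metis s i assms(3) gmul_assoc idempotents_commute)
  ultimately show "s \<odot> s = s \<and> s \<odot> t = s" by simp
next
  assume "s \<odot> s = s \<and> s \<odot> t = s"
  with assms show "gis_le G s t"
    by (simp add: gis_le_iff gmul_star)
qed

lemma edge_idem_in_S: "e \<in> arcs G \<Longrightarrow> Elem (edge_path G e) (edge_path G e) \<in> S G"
  by (simp add: edge_path_def FP_Cons_iff)

end

section \<open>Homomorphisms\<close>

lemma extended_path_homD:
  assumes "wf_digraph E" "wf_digraph F" "extended_path_hom E F \<phi>"
  shows "\<And>s. s \<in> S E \<Longrightarrow> \<phi> s \<in> S F"
    and "\<And>s t. s \<in> S E \<Longrightarrow> t \<in> S E \<Longrightarrow> \<phi> (s \<odot> t) = \<phi> s \<odot> \<phi> t"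
    and "\<phi> Zero = Zero"
proof -
  show mem: "\<phi> s \<in> S F" if "s \<in> S E" for s
    using assms(3) that by (auto simp: extended_path_hom_def)
  show "\<phi> (s \<odot> t) = \<phi> s \<odot> \<phi> t" if "s \<in> S E" "t \<in> S E" for s t
    using assms(3) that mem
    by (simp add: extended_path_hom_def wf_digraph.gis_mult_eq[OF assms(1)]
        wf_digraph.gis_mult_eq[OF assms(2)])
  show "\<phi> Zero = Zero"
    using assms(3) by (simp add: extended_path_hom_def)
qed

lemma extended_path_hom_id:
  assumes "wf_digraph E"
  shows "extended_path_hom E E (id_hom E)"
  using assms
  by (auto simp: extended_path_hom_def wf_digraph.gis_mult_eq wf_digraph.gmul_in_S
      wf_digraph.Zero_in_S)

lemma extended_path_hom_compose:
  assumes "wf_digraph E" "wf_digraph F" "extended_path_hom E F \<phi>" "extended_path_hom F G \<psi>"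
  shows "extended_path_hom E G (compose (S E) \<psi> \<phi>)"
proof -
  interpret E: wf_digraph E by fact
  have "gis_mult E s t \<in> S E" if "s \<in> S E" "t \<in> S E" for s t
    using that by (simp add: E.gis_mult_eq E.gmul_in_S)
  then show ?thesis
    using assms(3,4) by (fastforce simp: extended_path_hom_def compose_def PiE_iff)
qed

lemma extended_path_hom_idem:
  assumes "wf_digraph E" "wf_digraph F" "extended_path_hom E F \<phi>"
    "s \<in> S E" "s \<odot> s = s"
  shows "\<phi> s \<odot> \<phi> s = \<phi> s"
  using extended_path_homD(2)[OF assms(1-3), of s s] assms(4,5) by simp

text \<open>Since \<phi>(u,u) is idempotent, only idempotents lie below it. Regularity can therefore
  be used, and with the next lemma also proved, by testing idempotents under
  \<open>gmul\<close>.\<close>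

lemma regular_extended_path_homD:
  assumes "wf_digraph E" "wf_digraph F" "regular_extended_path_hom E F \<phi>"
    and u: "u \<in> reg E" and t: "t \<in> S F" "t \<noteq> Zero" "t \<odot> t = t" "t \<odot> \<phi> (Elem (u, []) (u, [])) = t"
  obtains e where "e \<in> out_arcs E u" "t \<odot> \<phi> (Elem (u, [e]) (u, [e])) \<noteq> Zero"
proof -
  interpret E: wf_digraph E by fact
  interpret F: wf_digraph F by fact
  have hom: "extended_path_hom E F \<phi>"
    using assms(3) by (simp add: regular_extended_path_hom_def)
  note \<phi> = extended_path_homD[OF assms(1,2) hom]
  let ?u = "Elem (u, []) (u, [])"
  have "?u \<in> S E"
    using u by (simp add: reg_def)
  then have "gis_le F t (\<phi> ?u)"
    using t \<phi>(1) extended_path_hom_idem[OF assms(1,2) hom, of ?u]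
    by (subst F.gis_le_idem_iff) auto
  then obtain e where e: "e \<in> out_arcs E u"
    "gis_mult F t (\<phi> (Elem (edge_path E e) (edge_path E e))) \<noteq> Zero"
    using assms(3) u t unfolding regular_extended_path_hom_def vertex_path_def by blast
  then have "t \<odot> \<phi> (Elem (u, [e]) (u, [e])) \<noteq> Zero"
    using E.edge_idem_in_S[of e] \<phi>(1) t(1) by (simp add: F.gis_mult_eq edge_path_def)
  with e(1) that show ?thesis by blast
qed

lemma regular_extended_path_homI:
  assumes "wf_digraph E" "wf_digraph F" and hom: "extended_path_hom E F \<phi>"
    and reg: "\<And>u t. \<lbrakk>u \<in> reg E; t \<in> S F; t \<noteq> Zero; t \<odot> t = t; t \<odot> \<phi> (Elem (u, []) (u, [])) = t\<rbrakk>
      \<Longrightarrow> \<exists>e\<in>out_arcs E u. t \<odot> \<phi> (Elem (u, [e]) (u, [e])) \<noteq> Zero"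
  shows "regular_extended_path_hom E F \<phi>"
  unfolding regular_extended_path_hom_def
proof (intro conjI ballI impI hom)
  interpret E: wf_digraph E by fact
  interpret F: wf_digraph F by fact
  note \<phi> = extended_path_homD[OF assms(1,2) hom]
  fix u t
  assume u: "u \<in> reg E" and t: "t \<in> S F - {Zero}"
    and le: "gis_le F t (\<phi> (Elem (vertex_path u) (vertex_path u)))"
  let ?u = "Elem (u, []) (u, [])"
  have "?u \<in> S E"
    using u by (simp add: reg_def)
  then have "t \<odot> t = t \<and> t \<odot> \<phi> ?u = t"
    using le t \<phi>(1) extended_path_hom_idem[OF assms(1,2) hom, of ?u]
    by (subst (asm) F.gis_le_idem_iff) (auto simp: vertex_path_def)
  with reg u t obtain e where e: "e \<in> out_arcs E u" "t \<odot> \<phi> (Elem (u, [e]) (u, [e])) \<noteq> Zero"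
    by blast
  then have "gis_mult F t (\<phi> (Elem (edge_path E e) (edge_path E e))) \<noteq> Zero"
    using E.edge_idem_in_S[of e] \<phi>(1) t by (simp add: F.gis_mult_eq edge_path_def)
  then show "\<exists>e\<in>out_arcs E u. gis_mult F t (\<phi> (Elem (edge_path E e) (edge_path E e))) \<noteq> Zero"
    using e(1) by (rule bexI)
qed

text \<open>A nonzero idempotent below (u,u) belongs to a path from \<open>u\<close>. If that path
  is trivial, any edge leaving \<open>u\<close> serves; otherwise its first edge does.\<close>

lemma regular_extended_path_hom_id:
  assumes "wf_digraph E"
  shows "regular_extended_path_hom E E (id_hom E)"
proof (rule regular_extended_path_homI[OF assms assms extended_path_hom_id[OF assms]])
  interpret E: wf_digraph E by fact
  fix u t
  assume u: "u \<in> reg E" and t: "t \<in> S E" "t \<noteq> Zero" "t \<odot> t = t"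
    and le: "t \<odot> id_hom E (Elem (u, []) (u, [])) = t"
  have edge: "id_hom E (Elem (u, [e]) (u, [e])) = Elem (u, [e]) (u, [e])" if "e \<in> out_arcs E u" for e
    using E.edge_idem_in_S[of e] that by (simp add: edge_path_def)
  have vertex: "id_hom E (Elem (u, []) (u, [])) = Elem (u, []) (u, [])"
    using u by (simp add: reg_def)
  obtain v p where tvp: "t = Elem (v, p) (v, p)"
    using t by (auto elim: idempotent_cases)
  have [simp]: "v = u"
    using le t(2) unfolding tvp vertex by (auto split: if_splits)
  obtain e where e: "e \<in> out_arcs E u"
    using u unfolding reg_def by blast
  show "\<exists>e\<in>out_arcs E u. t \<odot> id_hom E (Elem (u, [e]) (u, [e])) \<noteq> Zero"
  proof (cases p)
    case Nil
    then show ?thesis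
      using e edge tvp by (intro bexI[of _ e]) auto
  next
    case (Cons f q)
    then have "f \<in> out_arcs E u"
      using t(1) tvp by (auto simp: E.FP_Cons_iff)
    then show ?thesis
      using edge tvp Cons by (intro bexI[of _ f]) (auto simp: prefix_def)
  qed
qed

section \<open>Prolonging paths and finite covers\<close>

lemma regular_hom_extend_support:
  assumes wf: "wf_digraph F" "wf_digraph G" and reg: "regular_extended_path_hom F G \<psi>"
    and t: "t \<in> S G" "t \<odot> t = t"
    and p: "(a, p) \<in> FP F" "t \<odot> \<psi> (Elem (a, p) (a, p)) \<noteq> Zero"
    and v: "pre_digraph.awlast F a p \<in> reg F"
  obtains f where "(a, p @ [f]) \<in> FP F" "t \<odot> \<psi> (Elem (a, p @ [f]) (a, p @ [f])) \<noteq> Zero"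
proof -
  interpret F: wf_digraph F by fact
  interpret G: wf_digraph G by fact
  have hom: "extended_path_hom F G \<psi>"
    using reg by (simp add: regular_extended_path_hom_def)
  note \<psi> = extended_path_homD[OF wf hom]
  define v where "v = F.awlast a p"
  define d k k' w where "d = Elem (a, p) (a, p)" and "k = Elem (a, p) (v, [])"
    and "k' = Elem (v, []) (a, p)" and "w = Elem (v, []) (v, [] :: 'b list)"
  have "v \<in> verts F"
    using assms(8) by (simp add: v_def reg_def)
  then have S: "d \<in> S F" "k \<in> S F" "k' \<in> S F" "w \<in> S F"
    using p(1) by (auto simp: d_def k_def k'_def w_def v_def F.Elem_in_S_iff)
  have "k \<odot> k' = d" "k \<odot> w = k" "d \<odot> k = k"
    by (auto simp: k_def k'_def d_def w_def)
  then have \<psi>kk': "\<psi> k \<odot> \<psi> k' = \<psi> d" and \<psi>kw: "\<psi> k \<odot> \<psi> w = \<psi> k" and \<psi>dk: "\<psi> d \<odot> \<psi> k = \<psi> k"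
    using S \<psi>(2) by metis+
  have \<psi>d: "\<psi> d \<odot> \<psi> d = \<psi> d"
    using extended_path_hom_idem[OF wf hom S(1)] by (simp add: d_def)
  have comm: "\<psi> d \<odot> t = t \<odot> \<psi> d"
    using \<psi>d t(2) by (rule idempotents_commute)
  \<comment> \<open>Conjugation carries \<open>t\<close> from the path \<open>p\<close> to its
    target \<open>v\<close>. Carrying \<open>T\<close> back gives \<open>t\<close> times \<psi>(d),
    so \<open>T\<close> is nonzero; absorption of \<open>w\<close> by \<open>k\<close> puts
    \<open>T\<close> below \<psi>(w).\<close>
  define T where "T = \<psi> k' \<odot> t \<odot> \<psi> k"
  have "\<psi> k \<odot> T \<odot> \<psi> k' = \<psi> d \<odot> t \<odot> \<psi> d"
    unfolding T_def by (metis gmul_assoc \<psi>kk')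
  also have "\<dots> = t \<odot> \<psi> d"
    by (metis gmul_assoc \<psi>d comm)
  finally have "T \<noteq> Zero"
    using p(2) by (auto simp: d_def)
  moreover have "T \<in> S G"
    unfolding T_def by (intro G.gmul_in_S \<psi>(1) S t)
  moreover have "T \<odot> T = T"
  proof -
    \<comment> \<open>The inner factor \<psi>(k)\<psi>(k') collapses to \<psi>(d), which commutes
      with \<open>t\<close> and is absorbed by \<psi>(k).\<close>
    have "T \<odot> T = \<psi> k' \<odot> (t \<odot> (\<psi> d \<odot> t) \<odot> \<psi> k)"
      unfolding T_def \<psi>kk'[symmetric] by (simp add: gmul_assoc)
    also have "t \<odot> (\<psi> d \<odot> t) = t \<odot> \<psi> d"
      by (metis comm gmul_assoc t(2))
    also have "\<psi> k' \<odot> (t \<odot> \<psi> d \<odot> \<psi> k) = T"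
      unfolding T_def by (simp add: gmul_assoc \<psi>dk)
    finally show ?thesis .
  qed
  moreover have "T \<odot> \<psi> (Elem (v, []) (v, [])) = T"
    using \<psi>kw by (simp add: T_def gmul_assoc w_def)
  ultimately obtain f where f: "f \<in> out_arcs F v" "T \<odot> \<psi> (Elem (v, [f]) (v, [f])) \<noteq> Zero"
    using regular_extended_path_homD[OF wf reg] assms(8) v_def by metis
  define c where "c = Elem (a, p @ [f]) (a, p @ [f])"
  have FP: "(v, [f]) \<in> FP F" "(a, p @ [f]) \<in> FP F"
    using f(1) p(1) by (auto simp: F.FP_append_iff F.FP_Cons_iff v_def)
  \<comment> \<open>Both sides equal (pf, f). Moving the edge idempotent across \<open>k\<close>
    turns a statement at \<open>v\<close> into one about the prolonged path.\<close>
  have "k \<odot> Elem (v, [f]) (v, [f]) = c \<odot> k"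
    by (auto simp: k_def c_def)
  then have "\<psi> k \<odot> \<psi> (Elem (v, [f]) (v, [f])) = \<psi> c \<odot> \<psi> k"
    using \<psi>(2) S FP by (metis F.Elem_self_in_S c_def)
  then have "T \<odot> \<psi> (Elem (v, [f]) (v, [f])) = \<psi> k' \<odot> (t \<odot> \<psi> c) \<odot> \<psi> k"
    by (simp add: T_def gmul_assoc)
  then have "t \<odot> \<psi> c \<noteq> Zero"
    using f(2) by auto
  with FP(2) that show ?thesis
    by (simp add: c_def)
qed

lemma regular_hom_finite_cover:
  assumes wf: "wf_digraph F" "wf_digraph G" and reg: "regular_extended_path_hom F G \<psi>"
    and \<Gamma>: "finite \<Gamma>" "\<And>r. r \<in> \<Gamma> \<Longrightarrow> (a, r) \<in> FP F"
    and cover: "\<And>q. (a, p @ q) \<in> FP F \<Longrightarrow> \<exists>r\<in>\<Gamma>. prefix (p @ q) r \<or> prefix r (p @ q)"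
    and t: "t \<in> S G" "t \<noteq> Zero" "t \<odot> t = t" "t \<odot> \<psi> (Elem (a, p) (a, p)) = t"
    and p: "(a, p) \<in> FP F"
  shows "\<exists>r\<in>\<Gamma>. t \<odot> \<psi> (Elem (a, r) (a, r)) \<noteq> Zero"
proof (rule ccontr)
  interpret F: wf_digraph F by fact
  interpret G: wf_digraph G by fact
  have hom: "extended_path_hom F G \<psi>"
    using reg by (simp add: regular_extended_path_hom_def)
  note \<psi> = extended_path_homD[OF wf hom]
  assume "\<not> ?thesis"
  then have zero: "t \<odot> \<psi> (Elem (a, r) (a, r)) = Zero" if "r \<in> \<Gamma>" for r
    using that by blast
  \<comment> \<open>If \<open>r\<close> were a prefix of \<open>q\<close>, then \<psi>(q,q) would
    lie below \<psi>(r,r), and \<open>t\<close> would annihilate both.\<close>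
  have not_prefix: "\<not> prefix r q"
    if "r \<in> \<Gamma>" "(a, q) \<in> FP F" "t \<odot> \<psi> (Elem (a, q) (a, q)) \<noteq> Zero" for r q
  proof
    assume "prefix r q"
    then have "\<psi> (Elem (a, q) (a, q)) = \<psi> (Elem (a, r) (a, r)) \<odot> \<psi> (Elem (a, q) (a, q))"
      using \<psi>(2) \<Gamma>(2) that by (metis F.Elem_self_in_S gmul_idem_prefix)
    then have "t \<odot> \<psi> (Elem (a, q) (a, q)) = Zero"
      using zero[OF that(1)] by (metis gmul_assoc gmul.simps(2))
    with that show False by simp
  qed
  have long: "\<exists>q. length q = n \<and> (a, p @ q) \<in> FP F \<and> t \<odot> \<psi> (Elem (a, p @ q) (a, p @ q)) \<noteq> Zero" for n
  proof (induction n)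
    case 0
    then show ?case using p t by auto
  next
    case (Suc n)
    then obtain q where q: "length q = n" "(a, p @ q) \<in> FP F"
      "t \<odot> \<psi> (Elem (a, p @ q) (a, p @ q)) \<noteq> Zero"
      by blast
    let ?v = "F.awlast a (p @ q)"
    \<comment> \<open>The member of \<Gamma> comparable with the prolonged path cannot end before
      \<open>f\<close>, so \<open>f\<close> occurs in it. The edges leaving \<open>?v\<close> thus
      lie among the finitely many edges occurring in \<Gamma>.\<close>
    have "f \<in> (\<Union>r\<in>\<Gamma>. set r)" if "f \<in> out_arcs F ?v" for f
    proof -
      have "(?v, [f]) \<in> FP F"
        using that by (simp add: F.FP_Cons_iff)
      then have "(a, p @ (q @ [f])) \<in> FP F"
        using q(2) F.FP_append_iff[of a "p @ q" "[f]"] by simp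
      then obtain r where r: "r \<in> \<Gamma>" "prefix ((p @ q) @ [f]) r \<or> prefix r ((p @ q) @ [f])"
        using cover by fastforce
      moreover have "\<not> prefix r (p @ q)"
        using not_prefix r(1) q by blast
      ultimately have "prefix ((p @ q) @ [f]) r"
        by (auto simp only: prefix_snoc)
      then have "f \<in> set r"
        by (auto simp: prefix_def)
      with r(1) show ?thesis by blast
    qed
    then have "out_arcs F ?v \<subseteq> (\<Union>r\<in>\<Gamma>. set r)" by blast
    then have "finite (out_arcs F ?v)"
      by (rule finite_subset) (simp add: \<Gamma>(1))
    moreover have "out_arcs F ?v \<noteq> {}"
    proof -
      \<comment> \<open>Some member of \<Gamma> properly prolongs \<open>p @ q\<close>; its next
        edge leaves \<open>?v\<close>.\<close>
      obtain r where r: "r \<in> \<Gamma>" "prefix (p @ q) r" "\<not> prefix r (p @ q)"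
        using cover[OF q(2)] not_prefix q by blast
      then obtain f s where "r = (p @ q) @ f # s"
        by (metis append_Nil2 neq_Nil_conv prefix_def prefix_order.order_refl)
      then have "(?v, f # s) \<in> FP F"
        using \<Gamma>(2)[OF r(1)] F.FP_append_iff by blast
      then show ?thesis
        by (auto simp: F.FP_Cons_iff)
    qed
    moreover have "?v \<in> verts F"
      using q(2) F.FP_append_iff[of a "p @ q" "[]"] by simp
    ultimately have "?v \<in> reg F"
      by (simp add: reg_def)
    then obtain f where "(a, (p @ q) @ [f]) \<in> FP F"
      "t \<odot> \<psi> (Elem (a, (p @ q) @ [f]) (a, (p @ q) @ [f])) \<noteq> Zero"
      using regular_hom_extend_support[OF wf reg t(1,3) q(2,3)] by blast
    with q(1) show ?case
      by (intro exI[of _ "q @ [f]"]) simp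
  qed
  \<comment> \<open>The length is chosen so that no member of \<Gamma> can properly prolong
    \<open>p @ q\<close>. Were \<Gamma> empty, \<open>Max\<close> would be unspecified, but the
    cover supplies a member before the bound is used.\<close>
  obtain q where q: "length q = Max (length ` \<Gamma>)" "(a, p @ q) \<in> FP F"
    "t \<odot> \<psi> (Elem (a, p @ q) (a, p @ q)) \<noteq> Zero"
    using long by blast
  obtain r where r: "r \<in> \<Gamma>" "prefix (p @ q) r" "\<not> prefix r (p @ q)"
    using cover[OF q(2)] not_prefix q by blast
  have "length r \<le> length q"
    using r(1) \<Gamma>(1) q(1) by simp
  with r(2,3) show False
    by (auto simp: prefix_def)
qed

lemma regular_extended_path_hom_compose:
  assumes wf: "wf_digraph E" "wf_digraph F" "wf_digraph G"
    and reg: "regular_extended_path_hom E F \<phi>" "regular_extended_path_hom F G \<psi>"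
  shows "regular_extended_path_hom E G (compose (S E) \<psi> \<phi>)"
proof (rule regular_extended_path_homI[OF wf(1,3)])
  interpret E: wf_digraph E by fact
  interpret F: wf_digraph F by fact
  interpret G: wf_digraph G by fact
  have hom: "extended_path_hom E F \<phi>" "extended_path_hom F G \<psi>"
    using reg by (simp_all add: regular_extended_path_hom_def)
  show "extended_path_hom E G (compose (S E) \<psi> \<phi>)"
    using extended_path_hom_compose wf(1,2) hom by blast
  note \<phi> = extended_path_homD[OF wf(1,2) hom(1)]
  note \<psi> = extended_path_homD[OF wf(2,3) hom(2)]
  fix u t
  assume u: "u \<in> reg E" and t: "t \<in> S G" "t \<noteq> Zero" "t \<odot> t = t"
    and "t \<odot> compose (S E) \<psi> \<phi> (Elem (u, []) (u, [])) = t"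
  let ?u = "Elem (u, []) (u, [])" and ?e = "\<lambda>e. Elem (u, [e]) (u, [e])"
  note \<open>t \<odot> compose (S E) \<psi> \<phi> ?u = t\<close>
  moreover have uS: "?u \<in> S E"
    using u by (simp add: reg_def)
  ultimately have tu: "t \<odot> \<psi> (\<phi> ?u) = t"
    by (simp add: compose_def)
  \<comment> \<open>Otherwise \<psi> would send it to \<open>Zero\<close>, and \<open>t\<close>
    would vanish.\<close>
  with t(2) \<psi>(3) have "\<phi> ?u \<noteq> Zero"
    by auto
  then obtain a p where ap: "\<phi> ?u = Elem (a, p) (a, p)"
    using extended_path_hom_idem[OF wf(1,2) hom(1) uS] by (auto elim: idempotent_cases)
  then have apFP: "(a, p) \<in> FP F"
    using \<phi>(1)[OF uS] by simp
  have eS: "?e e \<in> S E" if "e \<in> out_arcs E u" for e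
    using E.edge_idem_in_S[of e] that by (simp add: edge_path_def)
  \<comment> \<open>Edges whose image is \<open>Zero\<close> or sits at a path with source other
    than \<open>a\<close> are dropped: such an image annihilates every idempotent at a path from
    \<open>a\<close>.\<close>
  define \<Gamma> where "\<Gamma> = {r. \<exists>e\<in>out_arcs E u. \<phi> (?e e) = Elem (a, r) (a, r)}"
  have "inj (\<lambda>r. Elem (a, r) (a, r))"
    by (auto intro: injI)
  then have "finite \<Gamma>"
    unfolding \<Gamma>_def using u
    \<comment> \<open>\<Gamma> lies in the preimage, under the injective map from \<open>r\<close>
      to its idempotent, of the finite set of images of edges leaving \<open>u\<close>.\<close>
    by (intro finite_subset[OF _ finite_vimageI[of "(\<lambda>e. \<phi> (?e e)) ` out_arcs E u" "\<lambda>r. Elem (a, r) (a, r)"]])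
      (auto simp: reg_def intro!: image_eqI[OF sym])
  moreover have "(a, r) \<in> FP F" if r: "r \<in> \<Gamma>" for r
  proof -
    obtain e where "e \<in> out_arcs E u" "\<phi> (?e e) = Elem (a, r) (a, r)"
      using r unfolding \<Gamma>_def by blast
    then show ?thesis
      using \<phi>(1)[OF eS, of e] by simp
  qed
  moreover have "\<exists>r\<in>\<Gamma>. prefix (p @ q) r \<or> prefix r (p @ q)" if q: "(a, p @ q) \<in> FP F" for q
  proof -
    let ?q = "Elem (a, p @ q) (a, p @ q)"
    \<comment> \<open>The idempotent at a prolongation of \<open>p\<close> lies below \<phi>(u,u),
      so regularity of \<phi> yields the edge whose image meets it.\<close>
    have "?q \<odot> \<phi> ?u = ?q"
      by (auto simp: ap prefix_def)
    then obtain e where e: "e \<in> out_arcs E u" "?q \<odot> \<phi> (?e e) \<noteq> Zero"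
      using regular_extended_path_homD[OF wf(1,2) reg(1) u, of ?q] q by auto
    have "\<phi> (?e e) \<odot> \<phi> (?e e) = \<phi> (?e e)"
      using extended_path_hom_idem[OF wf(1,2) hom(1) eS[OF e(1)]] by simp
    then obtain b r where br: "\<phi> (?e e) = Elem (b, r) (b, r)"
      using e(2) by (cases rule: idempotent_cases) (simp, metis surj_pair)
    have r: "a = b \<and> (prefix (p @ q) r \<or> prefix r (p @ q))"
      using e(2) unfolding br gmul_idem_nonzero_iff .
    with e(1) br have "r \<in> \<Gamma>"
      unfolding \<Gamma>_def by blast
    with r show ?thesis by blast
  qed
  ultimately have "\<exists>r\<in>\<Gamma>. t \<odot> \<psi> (Elem (a, r) (a, r)) \<noteq> Zero"
    using t tu apFP unfolding ap by (rule regular_hom_finite_cover[OF wf(2,3) reg(2)])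
  then obtain e where "e \<in> out_arcs E u" "t \<odot> \<psi> (\<phi> (?e e)) \<noteq> Zero"
    unfolding \<Gamma>_def by force
  with eS show "\<exists>e\<in>out_arcs E u. t \<odot> compose (S E) \<psi> \<phi> (?e e) \<noteq> Zero"
    by (auto simp: compose_def)
qed

section \<open>The categories\<close>

lemma category_EG: "category EG"
proof
  fix A B f
  assume "A \<in> obj EG" "B \<in> obj EG" "f \<in> hom EG A B"
  then have "f \<in> S A \<rightarrow>\<^sub>E S B"
    by (simp add: EG_def extended_path_hom_def)
  then show "compos EG A A B f (ident EG A) = f" "compos EG A B B (ident EG B) f = f"
    by (auto simp: EG_def PiE_def compose_Id Id_compose)
next
  fix A B D K f g h
  assume "f \<in> hom EG A B"
  then have "f \<in> S A \<rightarrow> S B"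
    by (auto simp: EG_def extended_path_hom_def)
  then show "compos EG A D K h (compos EG A B D g f) = compos EG A B K (compos EG B D K h g) f"
    by (simp add: EG_def compose_assoc)
qed (auto simp: EG_def extended_path_hom_id intro: extended_path_hom_compose)

text \<open>The unit and associativity laws are inherited from \<open>C\<close>, so only closure
  under identities and composition has to be checked.\<close>

lemma category_subfamily:
  assumes "category C" "obj D \<subseteq> obj C"
    "\<And>A B. A \<in> obj D \<Longrightarrow> B \<in> obj D \<Longrightarrow> hom D A B \<subseteq> hom C A B"
    "ident D = ident C" "compos D = compos C"
    "\<And>A. A \<in> obj D \<Longrightarrow> ident C A \<in> hom D A A"
    "\<And>A B K f g. \<lbrakk>A \<in> obj D; B \<in> obj D; K \<in> obj D; f \<in> hom D A B; g \<in> hom D B K\<rbrakk>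
      \<Longrightarrow> compos C A B K g f \<in> hom D A K"
  shows "subcategory D C"
proof -
  interpret category C by fact
  have "category D"
    using assms(2-)
    by unfold_locales
      (auto simp: subset_iff comp_ident ident_comp intro: comp_assoc)
  with assms show ?thesis
    by (simp add: subcategory_def)
qed

lemma subcategory_REG_EG: "subcategory REG EG"
  by (rule category_subfamily[OF category_EG])
    (auto simp: REG_def EG_def regular_extended_path_hom_id
      regular_extended_path_hom_def[THEN iffD1, THEN conjunct1]
      intro: regular_extended_path_hom_compose)

theorem theorem4p7:
  shows
    "(\<forall>E :: ('v, 'e) pre_digraph. wf_digraph E \<longrightarrow>
        regular_extended_path_hom E E (id_hom E)) \<and>
     (\<forall>(E :: ('v1, 'e1) pre_digraph) (F :: ('v2, 'e2) pre_digraph) (G :: ('v3, 'e3) pre_digraph) \<phi> \<psi>.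
        wf_digraph E \<longrightarrow> wf_digraph F \<longrightarrow> wf_digraph G \<longrightarrow>
        regular_extended_path_hom E F \<phi> \<longrightarrow> regular_extended_path_hom F G \<psi> \<longrightarrow>
        regular_extended_path_hom E G (compose (S E) \<psi> \<phi>)) \<and>
     subcategory (REG :: (('v, 'e) pre_digraph, ('v, 'e) gis \<Rightarrow> ('v, 'e) gis) precategory) EG"
  using regular_extended_path_hom_id regular_extended_path_hom_compose subcategory_REG_EG
  by blast

end
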